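(* Let $q=r^{2}$, where $r$ is an odd prime power. Let $m$ and $s$ be positive integers such that $m\mid q-1$, $s$ is even, $s\mid m$ and $s\mid r+1$. Let $t$ be an integer with $1\leq t\leq \frac{s(r-1)}{\gcd(s(r-1),m)}$. (i) If $n=tm$ and both $\frac{q-1}{m}$ and $\frac{r+1}{s}$ are even, then there exists a $q$-ary $[n,\frac{n}{2}]$ MDS self-dual code. (ii) If $n=tm+2$, then there exists a $q$-ary $[n,\frac{n}{2}]$ MDS self-dual code.
   Context: $\mathbb{F}_q$ denotes the finite field with $q$ elements. A $q$-ary $[n,k,d]$ code (or $[n,k]$ code, when $d$ is not specified) is an $\mathbb{F}_q$-linear subspace $C\subseteq\mathbb{F}_q^n$ of dimension $k$ with minimum (Hamming) distance $d$. It is called MDS (maximum distance separable) if $k+d=n+1$. The dual $C^{\perp}$ is the orthogonal complement of $C$ in $\mathbb{F}_q^n$ with respect to the standard Euclidean bilinear form $\langle x,y\rangle=\sum_{i=1}^n x_iy_i$, and $C$ is self-dual if $C=C^{\perp}$. An MDS self-dual code of length $n$ thus has parameters $[n,\frac n2,\frac n2+1]$. *)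

theory Defs
  imports "HOL-Analysis.Cartesian_Space" "HOL-Number_Theory.Prime_Powers"
begin

text \<open>
  Words of length \<open>n\<close> over a field \<open>'a\<close> are elements of \<^typ>\<open>'a ^ 'n\<close> with \<open>CARD('n) = n\<close>.
  The constants \<open>vec.subspace\<close> and \<open>vec.dim\<close> are linearity and dimension over \<open>'a\<close>
  (not over the reals, as for the unqualified \<open>subspace\<close> and \<open>dim\<close>).
\<close>

definition hamming_dist :: "'a ^ 'n \<Rightarrow> 'a ^ 'n \<Rightarrow> nat" where
  "hamming_dist x y = card {i. x $ i \<noteq> y $ i}"

text \<open>
  The infimum is attained as soon as the code has two words; otherwise it is \<open>Inf {} = 0\<close>.
\<close>

definition min_dist :: "('a ^ 'n) set \<Rightarrow> nat" where
  "min_dist C = Inf {hamming_dist x y |x y. x \<in> C \<and> y \<in> C \<and> x \<noteq> y}"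

definition linear_code :: "('a::field ^ 'n) set \<Rightarrow> nat \<Rightarrow> bool" where
  "linear_code C k \<longleftrightarrow> vec.subspace C \<and> vec.dim C = k"

definition mds :: "('a::field ^ 'n) set \<Rightarrow> bool" where
  "mds C \<longleftrightarrow> vec.dim C + min_dist C = CARD('n) + 1"

definition dual_code :: "('a::field ^ 'n) set \<Rightarrow> ('a ^ 'n) set" where
  "dual_code C = {y. \<forall>x\<in>C. (\<Sum>i\<in>UNIV. x $ i * y $ i) = 0}"

definition self_dual :: "('a::field ^ 'n) set \<Rightarrow> bool" where
  "self_dual C \<longleftrightarrow> C = dual_code C"

end

theory Submission
  imports Defs "HOL-Number_Theory.Residues" "HOL-Computational_Algebra.Polynomial"
begin

text \<open>
  A generalized Reed-Solomon code of dimension \<open>n div 2\<close> on a point set \<open>A\<close> can be scaled to a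
  self-dual one as soon as every value \<open>f'(a)\<close>, \<open>a \<in> A\<close>, of the derivative of \<open>f = (\<Prod>b\<in>A. X - b)\<close>
  is a nonzero square: its square roots, inverted, serve as column multipliers, and orthogonality is
  the residue theorem for \<open>h / f\<close>. If moreover \<open>- 1\<close> is a square, a point at infinity may be added.
  Let \<open>\<theta>\<close> be a primitive element, \<open>e = (r + 1) / s\<close> and \<open>d = (q - 1) / m\<close>. The points
  \<open>\<theta> ^ (e k + d j)\<close>, \<open>k < t\<close>, \<open>j < m\<close>, form \<open>t\<close> cosets of the \<open>m\<close>-th roots of unity, so that
  \<open>f = (\<Prod>k<t. X^m - g k)\<close> with \<open>g k = \<theta> ^ (e m k)\<close>. Since \<open>s\<close> divides \<open>m\<close>, all \<open>g k\<close> lie in the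
  subfield of order \<open>r\<close>, whose elements are squares in the big field. Hence \<open>f'(a)\<close> is \<open>a ^ (m - 1)\<close>
  times a square; in (i) all points are squares themselves, and in (ii) adding \<open>0\<close> to the points
  multiplies \<open>f'(a)\<close> by \<open>a\<close>, which moves it into the subfield.
\<close>

section \<open>Finite fields of square order\<close>

text \<open>Cyclicity of the multiplicative group is carried over from the ring record
  \<open>R\<close> built on the operations of the type class.\<close>

lemma finite_field_generator:
  obtains \<theta> :: "'a::{field,finite}"
  where "\<theta> \<noteq> 0" "\<And>x. x \<noteq> 0 \<Longrightarrow> \<exists>i. x = \<theta> ^ i"
    "\<And>i. \<theta> ^ i = 1 \<longleftrightarrow> CARD('a) - 1 dvd i"
proof -
  define R :: "'a ring" where "R = \<lparr>carrier = UNIV, monoid.mult = (*), one = 1, ring.zero = 0, add = (+)\<rparr>"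
  have inv: "\<exists>y. x + y = 0" "x \<noteq> 0 \<Longrightarrow> \<exists>y. x * y = 1" for x :: 'a
    by (rule exI[of _ "- x"], simp) (rule exI[of _ "inverse x"], simp)
  interpret R: field R
    unfolding R_def using inv by unfold_locales (auto simp: algebra_simps Units_def)
  have pow: "x [^]\<^bsub>R\<^esub> (i::nat) = x ^ i" for x i
    by (induction i) (auto simp: R_def nat_pow_def mult.commute)
  have car: "carrier (mult_of R) = UNIV - {0}"
    by (simp add: R_def)
  obtain g where g: "g \<in> carrier (mult_of R)" "carrier (mult_of R) = {g [^]\<^bsub>R\<^esub> i | i::nat. i \<in> UNIV}"
    using R.finite_field_mult_group_has_gen by (auto simp: R_def)
  have g0: "g \<noteq> 0" and gen: "\<And>x. x \<noteq> 0 \<Longrightarrow> \<exists>i. x = g ^ i"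
    using g unfolding car pow by auto
  interpret G: Group.group "mult_of R" by (rule R.field_mult_group)
  have fin: "finite (carrier (mult_of R))" by simp
  have ordc: "Coset.order (mult_of R) = CARD('a) - 1"
    unfolding Coset.order_def car by simp
  have gpow: "g [^]\<^bsub>mult_of R\<^esub> (i::nat) = g ^ i" for i
    by (simp add: nat_pow_mult_of pow)
  \<comment> \<open>The powers with exponent below \<open>G.ord g\<close> already exhaust the group,
    so its order is at most \<open>G.ord g\<close>; the reverse inequality holds for every
    element.\<close>
  have "carrier (mult_of R) = (\<lambda>i. g ^ i) ` {0..G.ord g - 1}"
    using G.ord_elems[OF fin g(1)] g(2) by (auto simp: gpow pow)
  hence "Coset.order (mult_of R) \<le> G.ord g"
    using G.ord_ge_1[OF fin g(1)] card_image_le[of "{0..G.ord g - 1}" "\<lambda>i. g ^ i"]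
    by (simp add: Coset.order_def)
  hence "G.ord g = CARD('a) - 1"
    using G.ord_dvd_group_order[OF g(1)] ordc fin G.ord_le_group_order[OF fin g(1)] by linarith
  hence "g ^ i = 1 \<longleftrightarrow> CARD('a) - 1 dvd i" for i
    using G.pow_eq_id[OF g(1), of i] gpow[of i] by (simp add: R_def)
  with g0 gen show ?thesis using that by blast
qed

text \<open>The characteristic divides \<open>r\<^sup>2\<close>, so it is the prime underlying
  \<open>r\<close>. This makes raising to the power \<open>r\<close> an iterate of the Frobenius
  map, hence additive.\<close>

lemma primepow_CHAR_power:
  assumes "CARD('a::{field,finite}) = r\<^sup>2" "primepow r"
  obtains e where "prime CHAR('a)" "r = CHAR('a) ^ e"
proof -
  have pr: "prime CHAR('a)"
    by (intro prime_CHAR_semidom finite_imp_CHAR_pos) simp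
  obtain p e where pe: "prime p" "r = p ^ e"
    using assms(2) by (auto simp: primepow_def)
  have "CHAR('a) dvd r\<^sup>2" using CHAR_dvd_CARD[where 'a='a] assms(1) by simp
  hence "CHAR('a) dvd p" using pr pe(2) by (meson prime_dvd_power)
  hence "CHAR('a) = p" using pr pe(1) by (simp add: primes_dvd_imp_eq)
  thus ?thesis using that pr pe by blast
qed

context
  fixes r :: nat
  assumes card_field: "CARD('a::{field,finite}) = r\<^sup>2" and odd_r: "odd r" and primepow_r: "primepow r"
begin

text \<open>The subfield of order \<open>r\<close> is the fixed set of raising to the power
  \<open>r\<close>. Membership is expressed by the equation \<open>x ^ r = x\<close>, and this lemma
  and the next four are its closure properties.\<close>

lemma frobenius_fixed_add: "(x + y) ^ r = (x::'a) + y" if "x ^ r = x" "y ^ r = y"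
  using primepow_CHAR_power[OF card_field primepow_r] freshmans_dream' that by metis

lemma frobenius_fixed_uminus: "(- x) ^ r = - (x::'a)" if "x ^ r = x"
  using that odd_r by simp

lemma frobenius_fixed_diff: "(x - y) ^ r = (x::'a) - y" if "x ^ r = x" "y ^ r = y"
  using frobenius_fixed_add[of x "- y"] frobenius_fixed_uminus[of y] that by simp

lemma frobenius_fixed_of_nat: "(of_nat n :: 'a) ^ r = of_nat n"
proof (induction n)
  case 0
  thus ?case using odd_pos[OF odd_r] by (simp add: power_0_left)
next
  case (Suc n)
  thus ?case using frobenius_fixed_add[of 1 "of_nat n"] by simp
qed

lemma frobenius_fixed_prod: "(\<Prod>i\<in>I. f i) ^ r = (\<Prod>i\<in>I. f i :: 'a)" if "\<And>i. i \<in> I \<Longrightarrow> f i ^ r = f i"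
  using that by (simp add: prod_power_distrib)

text \<open>If \<theta>^i is nonzero and fixed, then (r + 1)(r - 1) divides i(r - 1), so the even
  number r + 1 divides i.\<close>

lemma frobenius_fixed_is_square:
  assumes "x ^ r = (x::'a)"
  shows "\<exists>y. y\<^sup>2 = x"
proof (cases "x = 0")
  case False
  obtain \<theta> :: 'a where th: "\<theta> \<noteq> 0" "\<And>x. x \<noteq> 0 \<Longrightarrow> \<exists>i. x = \<theta> ^ i"
    "\<And>i. \<theta> ^ i = 1 \<longleftrightarrow> CARD('a) - 1 dvd i"
    using finite_field_generator[where 'a = 'a] by blast
  obtain i where i: "x = \<theta> ^ i" using th(2) False by blast
  have r: "r > 1" using primepow_r primepow_gt_Suc_0 by simp
  have "x * x ^ (r - 1) = x * 1" using assms r by (simp flip: power_Suc)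
  hence "x ^ (r - 1) = 1" using False by simp
  hence "CARD('a) - 1 dvd i * (r - 1)" using th(3) i by (metis power_mult)
  moreover have "CARD('a) - 1 = (r + 1) * (r - 1)"
    using r by (simp add: card_field power2_eq_square algebra_simps)
  ultimately have "r + 1 dvd i" using r dvd_times_right_cancel_iff[of "r - 1" "r + 1" i] by simp
  hence "even i" using odd_r by (meson dvd_trans even_plus_one_iff)
  then obtain j where "i = 2 * j" by blast
  thus ?thesis using i by (metis mult.commute power_mult)
qed (auto intro!: exI[of _ 0])

end

section \<open>Root polynomials of unions of cosets and their derivatives\<close>

lemma pderiv_prod_linear:
  fixes A :: "'a::field set"
  assumes "finite A" "a \<in> A"
  shows "poly (pderiv (\<Prod>b\<in>A. [:-b, 1:])) a = (\<Prod>b\<in>A - {a}. a - b)"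
proof -
  have "(\<Prod>b\<in>A. [:-b, 1:]) = [:-a, 1:] * (\<Prod>b\<in>A - {a}. [:-b, 1:])"
    using assms by (simp only: prod.remove)
  also have "poly (pderiv \<dots>) a = (\<Prod>b\<in>A - {a}. a - b)"
    by (simp add: pderiv_mult pderiv_pCons poly_prod del: mult_pCons_left)
  finally show ?thesis .
qed

lemma degree_prod_linear: "degree (\<Prod>b\<in>A. [:-b, 1::'a::field:]) = card A"
  by (subst degree_prod_eq_sum_degree) auto

text \<open>Both sides are monic of degree \<open>t * m\<close> and vanish on \<open>A\<close>.
  Because the leading terms cancel in the difference, \<open>t * m\<close> common roots suffice for
  equality.\<close>

lemma prod_linear_coset_union:
  fixes g :: "nat \<Rightarrow> 'a::field"
  assumes "m > 0" "finite A" "card A = t * m"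
    and root: "\<And>a. a \<in> A \<Longrightarrow> \<exists>k<t. a ^ m = g k"
  defines "P \<equiv> (\<Prod>k<t. monom 1 m - [:g k:])"
  shows "(\<Prod>b\<in>A. [:-b, 1:]) = P"
proof (rule poly_eqI_degree_lead_coeff)
  have deg: "degree (monom 1 m - [:g k:]) = m" for k
    using assms(1) by (intro antisym degree_diff_le le_degree) (auto simp: degree_monom_eq coeff_pCons split: nat.splits)
  have lc: "lead_coeff (monom 1 m - [:g k:]) = 1" for k
    unfolding deg using assms(1) by (auto simp: coeff_pCons split: nat.splits)
  have nz: "monom 1 m - [:g k:] \<noteq> 0" for k using lc[of k] by (metis leading_coeff_0_iff zero_neq_one)
  have degP: "degree P = t * m"
    unfolding P_def using nz by (subst degree_prod_eq_sum_degree) (auto simp: deg)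
  have lcP: "lead_coeff P = 1" unfolding P_def lead_coeff_prod by (simp only: lc) simp
  have "lead_coeff (\<Prod>b\<in>A. [:-b, 1:]) = 1" unfolding lead_coeff_prod by simp
  thus "coeff (\<Prod>b\<in>A. [:-b, 1:]) (t * m) = coeff P (t * m)"
    using lcP degP degree_prod_linear[of A] assms(3) by simp
  show "degree P \<le> t * m" "degree (\<Prod>b\<in>A. [:-b, 1:]) \<le> t * m" "t * m \<le> card A"
    using degP degree_prod_linear[of A] assms(3) by auto
  fix a assume a: "a \<in> A"
  have "poly P a = 0"
    using root[OF a] by (auto simp: P_def poly_prod poly_monom)
  thus "poly (\<Prod>b\<in>A. [:-b, 1:]) a = poly P a"
    using a assms(2) by (simp add: poly_prod)
qed

text \<open>The left side is f'(a). In the product rule only the term differentiating the k-th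
  factor survives at \<open>a\<close>, where that factor vanishes; every other factor takes the
  value \<open>g k - g l\<close>.\<close>

lemma prod_diff_coset_union:
  fixes g :: "nat \<Rightarrow> 'a::field"
  assumes "m > 0" "finite A" "card A = t * m"
    and root: "\<And>a. a \<in> A \<Longrightarrow> \<exists>k<t. a ^ m = g k"
    and "a \<in> A" "a ^ m = g k" "k < t"
  shows "(\<Prod>b\<in>A - {a}. a - b) = of_nat m * a ^ (m - 1) * (\<Prod>l\<in>{..<t} - {k}. g k - g l)"
proof -
  have "(\<Prod>b\<in>A - {a}. a - b) = poly (pderiv (\<Prod>k<t. monom 1 m - [:g k:])) a"
    using pderiv_prod_linear[OF assms(2,5)] prod_linear_coset_union[OF assms(1-4)] by simp
  also have "(\<Prod>k<t. monom 1 m - [:g k:]) =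
      (monom 1 m - [:g k:]) * (\<Prod>l\<in>{..<t} - {k}. monom 1 m - [:g l:])"
    using assms(7) by (simp add: prod.remove)
  finally show ?thesis
    using assms(6) by (simp add: pderiv_mult pderiv_diff pderiv_monom pderiv_pCons poly_monom poly_prod)
qed

section \<open>Extended generalized Reed-Solomon codes\<close>

text \<open>The third claim holds because each basis product is monic of degree
  \<open>card A - 1\<close>; it is what turns interpolation into a residue formula.\<close>

lemma lagrange_interpolation:
  fixes z :: "'a::field \<Rightarrow> 'a"
  assumes "finite A" "A \<noteq> {}"
  defines "L \<equiv> (\<Sum>a\<in>A. smult (z a / (\<Prod>b\<in>A - {a}. a - b)) (\<Prod>b\<in>A - {a}. [:-b, 1:]))"
  shows "degree L < card A" "\<And>a. a \<in> A \<Longrightarrow> poly L a = z a"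
    "coeff L (card A - 1) = (\<Sum>a\<in>A. z a / (\<Prod>b\<in>A - {a}. a - b))"
proof -
  have deg: "degree (\<Prod>b\<in>A - {a}. [:-b, 1:]) = card A - 1" if "a \<in> A" for a
    using degree_prod_linear[of "A - {a}"] that assms(1) by simp
  have "lead_coeff (\<Prod>b\<in>A - {a}. [:-b, 1:]) = 1" for a :: 'a
    unfolding lead_coeff_prod by simp
  hence lc: "coeff (\<Prod>b\<in>A - {a}. [:-b, 1:]) (card A - 1) = 1" if "a \<in> A" for a
    using deg[OF that] by metis
  have "degree L \<le> card A - 1"
    unfolding L_def using assms(1)
    by (intro degree_sum_le order.trans[OF degree_smult_le]) (auto simp: deg)
  moreover have "card A > 0" using assms by (simp add: card_gt_0_iff)
  ultimately show "degree L < card A" by linarith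
  show "coeff L (card A - 1) = (\<Sum>a\<in>A. z a / (\<Prod>b\<in>A - {a}. a - b))"
    unfolding L_def unfolding coeff_sum coeff_smult by (rule sum.cong) (simp_all add: lc del: One_nat_def)
  fix c assume c: "c \<in> A"
  have "poly L c = (\<Sum>a\<in>A. if a = c then z c else 0)"
    unfolding L_def poly_sum poly_smult poly_prod
  proof (rule sum.cong, goal_cases)
    case (2 a)
    show ?case
    proof (cases "a = c")
      case True
      have "(\<Prod>b\<in>A - {c}. c - b) \<noteq> 0" using assms(1) by (simp add: prod_zero_iff)
      thus ?thesis using True by simp
    next
      case False
      hence "(\<Prod>b\<in>A - {a}. poly [:-b, 1:] c) = 0"
        using c assms(1) by (intro prod_zero) auto
      thus ?thesis using False by simp
    qed
  qed simp
  thus "poly L c = z c" using c assms(1) by simp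
qed

text \<open>By its degree, \<open>h\<close> is its own interpolant on \<open>A\<close>, so the top
  coefficients agree. The right side is, up to sign, the residue of h/f at infinity.\<close>

lemma sum_residues:
  fixes h :: "'a::field poly"
  assumes "finite A" "degree h < card A"
  shows "(\<Sum>a\<in>A. poly h a / (\<Prod>b\<in>A - {a}. a - b)) = coeff h (card A - 1)"
proof -
  have ne: "A \<noteq> {}" using assms(2) by auto
  note L = lagrange_interpolation[OF assms(1) ne, where z = "poly h"]
  show ?thesis
    using L(3) poly_eqI_degree[OF L(2) L(1) assms(2)] by simp
qed

text \<open>Evaluation points are taken from the projective line, with \<open>None\<close> as the point at infinity;
  there a polynomial of degree at most \<open>d\<close> takes its coefficient of \<open>X\<^sup>d\<close> as value.\<close>

definition proj_eval :: "nat \<Rightarrow> 'a::field poly \<Rightarrow> 'a option \<Rightarrow> 'a" where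
  "proj_eval d p x = (case x of None \<Rightarrow> coeff p d | Some a \<Rightarrow> poly p a)"

definition grs_code :: "nat \<Rightarrow> ('n \<Rightarrow> 'a::field option) \<Rightarrow> ('n \<Rightarrow> 'a) \<Rightarrow> ('a ^ 'n) set" where
  "grs_code k x v = {\<chi> i. v i * proj_eval (k - 1) p (x i) | p. degree p < k}"

lemma proj_eval_add: "proj_eval d (p + q) x = proj_eval d p x + proj_eval d q x"
  and proj_eval_diff: "proj_eval d (p - q) x = proj_eval d p x - proj_eval d q x"
  and proj_eval_smult: "proj_eval d (smult c p) x = c * proj_eval d p x"
  and proj_eval_0: "proj_eval d 0 x = 0"
  by (auto simp: proj_eval_def split: option.splits)

section \<open>Dimension and minimum distance\<close>

context
  fixes x :: "'n::finite \<Rightarrow> 'a::field option" and v :: "'n \<Rightarrow> 'a" and k :: nat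
  assumes inj_x: "inj x" and v_nz: "\<And>i. v i \<noteq> 0" and k_pos: "k > 0" and k_le: "k \<le> CARD('n)"
begin

text \<open>A zero at infinity lowers the degree bound by one and hence costs one affine root, so
  the usual root bound extends to the projective line.\<close>

lemma card_proj_zeros:
  assumes "p \<noteq> 0" "degree p < k"
  shows "card {i. proj_eval (k - 1) p (x i) = 0} < k"
proof -
  let ?Z = "{i. proj_eval (k - 1) p (x i) = 0}"
  let ?R = "{a. poly p a = 0}"
  have fin: "finite ?R" using assms(1) by (rule poly_roots_finite)
  have "card ?Z = card (x ` ?Z)" using inj_x by (metis card_image inj_on_subset subset_UNIV)
  also have "\<dots> < k"
  proof (cases "coeff p (k - 1) = 0")
    case True
    hence "degree p \<noteq> k - 1" using assms(1) by (metis leading_coeff_0_iff)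
    hence deg: "degree p < k - 1" using assms(2) by linarith
    have "x ` ?Z \<subseteq> insert None (Some ` ?R)"
      by (auto simp: proj_eval_def image_iff split: option.splits) (metis option.exhaust)
    hence "card (x ` ?Z) \<le> card (insert None (Some ` ?R))"
      using fin by (intro card_mono) auto
    also have "\<dots> = Suc (card ?R)" using fin by (subst card_insert_disjoint) (auto simp: card_image)
    finally show ?thesis using card_poly_roots_bound[OF assms(1)] deg by linarith
  next
    case False
    have "x ` ?Z \<subseteq> Some ` ?R"
    proof
      fix y assume "y \<in> x ` ?Z"
      then obtain i where "y = x i" "proj_eval (k - 1) p (x i) = 0" by auto
      thus "y \<in> Some ` ?R" using False by (cases "x i") (auto simp: proj_eval_def)
    qed
    hence "card (x ` ?Z) \<le> card (Some ` ?R)" using fin by (intro card_mono) auto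
    also have "\<dots> = card ?R" by (simp add: card_image)
    finally show ?thesis using card_poly_roots_bound[OF assms(1)] assms(2) by linarith
  qed
  finally show ?thesis .
qed

definition grs_encode :: "'a poly \<Rightarrow> 'a ^ 'n" where
  "grs_encode p = (\<chi> i. v i * proj_eval (k - 1) p (x i))"

lemma grs_code_eq: "grs_code k x v = grs_encode ` {p. degree p < k}"
  by (auto simp: grs_code_def grs_encode_def)

lemma grs_encode_add: "grs_encode (p + q) = grs_encode p + grs_encode q"
  and grs_encode_diff: "grs_encode (p - q) = grs_encode p - grs_encode q"
  and grs_encode_smult: "grs_encode (smult c p) = c *s grs_encode p" and grs_encode_0: "grs_encode 0 = 0"
  by (simp_all add: grs_encode_def vec_eq_iff proj_eval_add proj_eval_diff proj_eval_smult proj_eval_0 algebra_simps)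

lemma grs_encode_sum: "grs_encode (\<Sum>i\<in>I. f i) = (\<Sum>i\<in>I. grs_encode (f i))"
  by (induction I rule: infinite_finite_induct) (auto simp: grs_encode_add grs_encode_0)

text \<open>Since the multipliers are nonzero, two words agree exactly at the projective zeros of
  \<open>p - q\<close>. The exact formula later serves to bound the minimum distance from above, the
  inequality to bound it from below.\<close>

lemma hamming_dist_grs_encode:
  assumes "p \<noteq> q" "degree p < k" "degree q < k"
  shows "hamming_dist (grs_encode p) (grs_encode q) = CARD('n) - card {i. proj_eval (k - 1) (p - q) (x i) = 0}"
    "hamming_dist (grs_encode p) (grs_encode q) \<ge> CARD('n) + 1 - k"
proof -
  have eq: "{i. grs_encode p $ i \<noteq> grs_encode q $ i} = UNIV - {i. proj_eval (k - 1) (p - q) (x i) = 0}"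
    using v_nz by (auto simp: grs_encode_def proj_eval_diff)
  show 1: "hamming_dist (grs_encode p) (grs_encode q) = CARD('n) - card {i. proj_eval (k - 1) (p - q) (x i) = 0}"
    unfolding hamming_dist_def eq by (subst card_Diff_subset) auto
  show "hamming_dist (grs_encode p) (grs_encode q) \<ge> CARD('n) + 1 - k"
    unfolding 1 using card_proj_zeros[of "p - q"] assms degree_diff_less[of p k q] by simp
qed

lemma grs_encode_inj: "inj_on grs_encode {p. degree p < k}"
proof (rule inj_onI, rule ccontr)
  fix p q assume *: "p \<in> {p. degree p < k}" "q \<in> {p. degree p < k}" "grs_encode p = grs_encode q" "p \<noteq> q"
  hence "hamming_dist (grs_encode p) (grs_encode q) = 0" by (simp add: hamming_dist_def)
  thus False using hamming_dist_grs_encode(2)[of p q] * k_le by simp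
qed

lemma linear_code_grs: "linear_code (grs_code k x v) k"
  unfolding linear_code_def
proof
  show sub: "vec.subspace (grs_code k x v)"
    unfolding vec.subspace_def grs_code_eq
  proof (intro conjI ballI allI)
    show "0 \<in> grs_encode ` {p. degree p < k}"
      using k_pos by (intro image_eqI[of _ _ 0]) (auto simp: grs_encode_0)
    fix y assume y: "y \<in> grs_encode ` {p. degree p < k}"
    then obtain p where p: "y = grs_encode p" "degree p < k" by auto
    show "c *s y \<in> grs_encode ` {p. degree p < k}" for c
      using p le_less_trans[OF degree_smult_le[of c p]]
      by (intro image_eqI[of _ _ "smult c p"]) (auto simp: grs_encode_smult)
    fix z assume "z \<in> grs_encode ` {p. degree p < k}"
    then obtain q where q: "z = grs_encode q" "degree q < k" by auto
    show "y + z \<in> grs_encode ` {p. degree p < k}"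
      using p q degree_add_less[of p k q] by (intro image_eqI[of _ _ "p + q"]) (auto simp: grs_encode_add)
  qed
  \<comment> \<open>The encoded monomials form the basis. A linear relation among them encodes a
    polynomial with the same coefficients, which is zero by injectivity of the encoder.\<close>
  let ?b = "\<lambda>j. grs_encode (monom 1 j)"
  let ?B = "?b ` {..<k}"
  have mon: "monom 1 j \<in> {p::'a poly. degree p < k}" if "j < k" for j
    using that by (simp add: degree_monom_eq)
  have inj: "inj_on ?b {..<k}"
  proof (rule inj_onI)
    fix i j assume "i \<in> {..<k}" "j \<in> {..<k}" "?b i = ?b j"
    hence "monom (1::'a) i = monom 1 j" using inj_onD[OF grs_encode_inj] mon by auto
    thus "i = j" by (metis degree_monom_eq one_neq_zero)
  qed
  have sum_monom: "degree (\<Sum>j<k. monom (c j) j) < k"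
    "grs_encode (\<Sum>j<k. monom (c j) j) = (\<Sum>j<k. c j *s ?b j)" for c :: "nat \<Rightarrow> 'a"
  proof -
    have "degree (\<Sum>j<k. monom (c j) j) \<le> k - 1"
      by (intro degree_sum_le) (auto intro: order.trans[OF degree_monom_le])
    thus "degree (\<Sum>j<k. monom (c j) j) < k" using k_pos by linarith
    show "grs_encode (\<Sum>j<k. monom (c j) j) = (\<Sum>j<k. c j *s ?b j)"
      by (simp add: grs_encode_sum grs_encode_smult[symmetric] smult_monom)
  qed
  have "vec.independent ?B"
    unfolding vec.dependent_finite[OF finite_imageI[OF finite_lessThan]]
  proof safe
    fix u j assume u: "(\<Sum>y\<in>?B. u y *s y) = 0" "j < k" "u (?b j) \<noteq> 0"
    have "grs_encode (\<Sum>j<k. monom (u (?b j)) j) = grs_encode 0"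
      using u(1) unfolding sum_monom sum.reindex[OF inj] by (simp add: grs_encode_0 o_def)
    hence "(\<Sum>j<k. monom (u (?b j)) j) = 0"
      using inj_onD[OF grs_encode_inj] sum_monom(1) k_pos by simp
    hence "coeff (\<Sum>j<k. monom (u (?b j)) j) j = 0" by simp
    thus False using u(2,3) by (simp add: coeff_sum)
  qed
  moreover have "?B \<subseteq> grs_code k x v" unfolding grs_code_eq using mon by blast
  moreover have "grs_code k x v \<subseteq> vec.span ?B"
  proof
    fix y assume "y \<in> grs_code k x v"
    then obtain p where p: "y = grs_encode p" "degree p < k" by (auto simp: grs_code_eq)
    have "p = (\<Sum>j<k. monom (coeff p j) j)"
      using p(2) by (intro poly_eqI) (auto simp: coeff_sum coeff_eq_0)
    hence y: "y = (\<Sum>j<k. coeff p j *s ?b j)" using p(1) sum_monom(2) by metis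
    show "y \<in> vec.span ?B"
      unfolding y
    proof (rule vec.span_sum)
      fix j assume "j \<in> {..<k}"
      thus "coeff p j *s ?b j \<in> vec.span ?B"
        by (intro vec.span_scale[OF vec.span_base] imageI)
    qed
  qed
  moreover have "card ?B = k" using inj by (simp add: card_image)
  ultimately show "vec.dim (grs_code k x v) = k" using vec.dim_unique by blast
qed

text \<open>The lower bound on distances is attained by a polynomial having \<open>k - 1\<close> of
  the affine evaluation points as its roots.\<close>

lemma mds_grs: "mds (grs_code k x v)"
proof -
  let ?D = "{hamming_dist y z |y z. y \<in> grs_code k x v \<and> z \<in> grs_code k x v \<and> y \<noteq> z}"
  let ?A = "{a. Some a \<in> range x}"
  have lower: "CARD('n) + 1 - k \<le> d" if d: "d \<in> ?D" for d
  proof -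
    obtain y z where yz: "d = hamming_dist y z" "y \<in> grs_code k x v" "z \<in> grs_code k x v" "y \<noteq> z"
      using d by (elim CollectE exE conjE) (rule that)
    obtain p q where pq: "y = grs_encode p" "z = grs_encode q" "degree p < k" "degree q < k"
    proof -
      obtain p where "y = grs_encode p" "degree p < k" using yz(2) unfolding grs_code_eq by auto
      moreover obtain q where "z = grs_encode q" "degree q < k" using yz(3) unfolding grs_code_eq by auto
      ultimately show ?thesis using that by simp
    qed
    hence "p \<noteq> q" using yz(4) by blast
    from hamming_dist_grs_encode(2)[OF this pq(3,4)] show ?thesis by (simp only: yz(1) pq)
  qed
  \<comment> \<open>At most one of the at least \<open>k\<close> evaluation points is infinite, so
    \<open>k - 1\<close> affine ones are available as roots.\<close>
  have "range x \<subseteq> insert None (Some ` ?A)"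
    by (auto simp: image_iff) (metis option.exhaust)
  moreover have finA: "finite ?A"
  proof -
    have "Some ` ?A \<subseteq> range x" by auto
    hence "finite (Some ` ?A)" by (rule finite_subset) simp
    thus ?thesis by (rule finite_imageD) simp
  qed
  ultimately have "card (range x) \<le> card (insert None (Some ` ?A))"
    by (intro card_mono) auto
  also have "\<dots> \<le> card ?A + 1"
    using finA by (subst card_insert_disjoint) (auto simp: card_image)
  finally have "k - 1 \<le> card ?A" using inj_x k_le by (simp add: card_image)
  then obtain B where B: "B \<subseteq> ?A" "card B = k - 1" "finite B"
    by (meson obtain_subset_with_card_n)
  define g where "g = (\<Prod>b\<in>B. [:-b, 1:])"
  have g: "degree g = k - 1" "g \<noteq> 0"
    using degree_prod_linear[of B] B by (auto simp: g_def)
  have "card B = card (Some ` B)" by (simp add: card_image)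
  also have "\<dots> \<le> card (x ` {i. proj_eval (k - 1) g (x i) = 0})"
  proof (intro card_mono subsetI)
    fix y assume "y \<in> Some ` B"
    then obtain b where b: "y = Some b" "b \<in> B" by auto
    then obtain i where "x i = Some b" using B(1) by fastforce
    moreover have "poly g b = 0" unfolding g_def poly_prod using b(2) B(3) by (intro prod_zero) auto
    ultimately show "y \<in> x ` {i. proj_eval (k - 1) g (x i) = 0}"
      using b by (auto simp: proj_eval_def image_iff intro!: exI[of _ i])
  qed simp
  also have "\<dots> \<le> card {i. proj_eval (k - 1) g (x i) = 0}" by (rule card_image_le) simp
  finally have "hamming_dist (grs_encode g) (grs_encode 0) \<le> CARD('n) + 1 - k"
    using hamming_dist_grs_encode(1)[of g 0] g k_pos B(2) by simp
  moreover have gD: "hamming_dist (grs_encode g) (grs_encode 0) \<in> ?D"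
  proof -
    have "grs_encode g \<noteq> grs_encode 0" using inj_onD[OF grs_encode_inj] g k_pos by fastforce
    thus ?thesis unfolding grs_code_eq using g k_pos by force
  qed
  ultimately have "hamming_dist (grs_encode g) (grs_encode 0) = CARD('n) + 1 - k"
    using lower by (meson antisym)
  hence "Inf ?D = CARD('n) + 1 - k"
    using gD lower by (metis (no_types, lifting) cInf_eq_minimum)
  thus ?thesis
    using linear_code_grs k_le unfolding mds_def min_dist_def linear_code_def by simp
qed

end

section \<open>Self-duality through residues\<close>

lemma coeff_mult_le_degree:
  fixes p q :: "'a::field poly"
  assumes "degree p \<le> m" "degree q \<le> n"
  shows "coeff (p * q) (m + n) = coeff p m * coeff q n"
proof (cases "degree p = m \<and> degree q = n")
  case True
  thus ?thesis using coeff_mult_degree_sum by metis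
next
  case False
  hence "degree p + degree q < m + n" "degree p < m \<or> degree q < n" using assms by linarith+
  thus ?thesis using degree_mult_le[of p q] by (auto simp: coeff_eq_0)
qed

context
  fixes x :: "'n::finite \<Rightarrow> 'a::field option" and v :: "'n \<Rightarrow> 'a" and A :: "'a set"
  assumes inj_x: "inj x" and finite_A: "finite A" and fin_points: "\<And>a. Some a \<in> range x \<longleftrightarrow> a \<in> A"
    and v_fin: "\<And>i a. x i = Some a \<Longrightarrow> (v i)\<^sup>2 = 1 / (\<Prod>b\<in>A - {a}. a - b)"
    and v_inf: "\<And>i. x i = None \<Longrightarrow> (v i)\<^sup>2 = - 1"
begin

lemma range_points: "range x = Some ` A \<union> (if None \<in> range x then {None} else {})"
proof (rule Set.set_eqI)
  fix y show "y \<in> range x \<longleftrightarrow> y \<in> Some ` A \<union> (if None \<in> range x then {None} else {})"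
    using fin_points by (cases y) auto
qed

lemma card_points: "CARD('n) = card A + (if None \<in> range x then 1 else 0)"
proof -
  have "CARD('n) = card (range x)" using inj_x by (simp add: card_image)
  also have "\<dots> = card A + (if None \<in> range x then 1 else 0)"
  proof (cases "None \<in> range x")
    case True
    hence "range x = insert None (Some ` A)" using range_points by auto
    thus ?thesis using True finite_A by (simp add: card_image)
  next
    case False
    hence "range x = Some ` A" using range_points by auto
    thus ?thesis using False by (simp add: card_image)
  qed
  finally show ?thesis .
qed

text \<open>The squared multipliers 1/f'(a) turn the affine part into a sum of residues, and the
  square -1 accounts for the sign at infinity. The value \<open>z None\<close> is left independent
  of \<open>p\<close> so that an arbitrary word of the dual can be treated as well.\<close>

lemma grs_pairing:
  assumes "\<And>a. a \<in> A \<Longrightarrow> z (Some a) = poly p a" "degree (p * g) < card A"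
  shows "(\<Sum>i\<in>UNIV. (v i * z (x i)) * (v i * proj_eval d g (x i))) =
    coeff (p * g) (card A - 1) - (if None \<in> range x then z None * coeff g d else 0)"
proof -
  define W where "W y = (case y of None \<Rightarrow> - (z None * coeff g d)
    | Some a \<Rightarrow> poly (p * g) a / (\<Prod>b\<in>A - {a}. a - b))" for y
  have "(\<Sum>i\<in>UNIV. (v i * z (x i)) * (v i * proj_eval d g (x i))) = (\<Sum>i\<in>UNIV. W (x i))"
  proof (rule sum.cong)
    fix i
    have "(v i * z (x i)) * (v i * proj_eval d g (x i)) = (v i)\<^sup>2 * (z (x i) * proj_eval d g (x i))"
      by (simp add: power2_eq_square)
    also have "\<dots> = W (x i)"
    proof (cases "x i")
      case None
      thus ?thesis by (simp add: W_def v_inf proj_eval_def)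
    next
      case (Some a)
      hence "a \<in> A" using fin_points by (metis rangeI)
      thus ?thesis using Some by (simp add: W_def v_fin proj_eval_def assms(1))
    qed
    finally show "(v i * z (x i)) * (v i * proj_eval d g (x i)) = W (x i)" .
  qed simp
  also have "\<dots> = sum W (range x)" using inj_x by (simp add: sum.reindex)
  also have "\<dots> = sum W (Some ` A) + (if None \<in> range x then W None else 0)"
    by (subst range_points, subst sum.union_disjoint) (use finite_A in auto)
  also have "sum W (Some ` A) = coeff (p * g) (card A - 1)"
    using sum_residues[OF finite_A assms(2)] by (simp add: sum.reindex W_def)
  finally show ?thesis by (simp add: W_def)
qed

text \<open>The second inclusion is shown without counting dimensions: a dual word is interpolated
  at the affine points, and pairing it with monomials forces the interpolant to have degree below
  \<open>k\<close> and the right value at infinity.\<close>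

lemma self_dual_grs:
  assumes card_n: "CARD('n) = 2 * k" and k_pos: "k > 0" and v_nz: "\<And>i. v i \<noteq> 0"
  shows "self_dual (grs_code k x v)"
  unfolding self_dual_def
proof
  show "grs_code k x v \<subseteq> dual_code (grs_code k x v)"
  proof (clarsimp simp: dual_code_def grs_code_def)
    fix p g :: "'a poly" assume deg: "degree p < k" "degree g < k"
    have *: "degree (p * g) < 2 * k - 1" using degree_mult_le[of p g] deg by linarith
    have "(\<Sum>i\<in>UNIV. (v i * proj_eval (k - 1) p (x i)) * (v i * proj_eval (k - 1) g (x i))) =
      coeff (p * g) (card A - 1) - (if None \<in> range x then proj_eval (k - 1) p None * coeff g (k - 1) else 0)"
      using * card_points card_n by (intro grs_pairing) (auto simp: proj_eval_def split: if_splits)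
    \<comment> \<open>With infinity, \<open>card A = 2 * k - 1\<close>, and the coefficient at 2k -
      2 is the product of the two values at infinity, which cancels. Without it,
      \<open>card A = 2 * k\<close>, and the coefficient at 2k - 1 exceeds the degree.\<close>
    also have "\<dots> = 0"
    proof (cases "None \<in> range x")
      case True
      hence "card A - 1 = (k - 1) + (k - 1)" using card_points card_n by simp
      thus ?thesis using True coeff_mult_le_degree[of p "k - 1" g "k - 1"] deg
        by (simp add: proj_eval_def)
    next
      case False
      hence "card A - 1 = 2 * k - 1" using card_points card_n by simp
      thus ?thesis using False * by (simp add: coeff_eq_0)
    qed
    finally show "(\<Sum>i\<in>UNIV. v i * proj_eval (k - Suc 0) g (x i) * (v i * proj_eval (k - Suc 0) p (x i))) = 0"
      by (simp add: mult.commute)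
  qed
next
  show "dual_code (grs_code k x v) \<subseteq> grs_code k x v"
  proof
    fix y assume y: "y \<in> dual_code (grs_code k x v)"
    \<comment> \<open>The word with its multipliers divided out, viewed as a function of the
      evaluation point.\<close>
    define z where "z o' = y $ inv_into UNIV x o' / v (inv_into UNIV x o')" for o'
    have zx: "v i * z (x i) = y $ i" for i
      using inj_x v_nz by (simp add: z_def)
    have orth: "(\<Sum>i\<in>UNIV. (v i * z (x i)) * (v i * proj_eval (k - 1) g (x i))) = 0"
      if "degree g < k" for g
    proof -
      have "(\<chi> i. v i * proj_eval (k - 1) g (x i)) \<in> grs_code k x v"
        using that by (auto simp: grs_code_def)
      hence "(\<Sum>i\<in>UNIV. (\<chi> i. v i * proj_eval (k - 1) g (x i)) $ i * y $ i) = 0"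
        using y unfolding dual_code_def by blast
      thus ?thesis by (simp add: zx mult.commute)
    qed
    have "card A > 0" using card_points card_n k_pos by (cases "card A") (auto split: if_splits)
    hence "A \<noteq> {}" by auto
    then obtain p where p: "degree p < card A" "\<And>a. a \<in> A \<Longrightarrow> poly p a = z (Some a)"
      using lagrange_interpolation(1,2)[OF finite_A, where z = "\<lambda>a. z (Some a)"] by blast
    have pair: "coeff (p * g) (card A - 1) = (if None \<in> range x then z None * coeff g (k - 1) else 0)"
      if "degree g < k" "degree (p * g) < card A" for g
      using grs_pairing[of z p g "k - 1"] p(2) that(2) orth[OF that(1)] by simp
    have deg_p: "degree p < k"
    proof (rule ccontr)
      assume ge: "\<not> degree p < k"
      hence p0: "p \<noteq> 0" using k_pos by auto
      \<comment> \<open>This shift moves the leading term of \<open>p\<close> to the degree that the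
        pairing reads off. If infinity is a point, \<open>?j < k - 1\<close>, so the monomial
        vanishes there.\<close>
      let ?j = "card A - 1 - degree p"
      let ?g = "monom 1 ?j :: 'a poly"
      have dg: "degree ?g = ?j" by (simp add: degree_monom_eq)
      have dpg: "degree (p * ?g) = card A - 1"
        using p0 p(1) dg by (subst degree_mult_eq) auto
      have jk: "?j < k" "None \<in> range x \<Longrightarrow> ?j < k - 1"
        using ge card_points card_n k_pos p(1) by auto
      have "coeff (p * ?g) (card A - 1) = 0"
        using pair[of ?g] jk dg dpg p(1) by (auto simp: coeff_eq_0)
      hence "lead_coeff (p * ?g) = 0" by (simp only: dpg)
      thus False using p0 by simp
    qed
    \<comment> \<open>Pairing with X^(k - 1), whose value at infinity is 1, compares
      \<open>z None\<close> with the value of \<open>p\<close> at infinity.\<close>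
    have inf: "z None = coeff p (k - 1)" if "None \<in> range x"
    proof -
      let ?g = "monom 1 (k - 1) :: 'a poly"
      have cA: "card A - 1 = (k - 1) + (k - 1)" using card_points card_n that by simp
      have dg: "degree ?g = k - 1" by (simp add: degree_monom_eq)
      have "degree (p * ?g) < card A"
        using degree_mult_le[of p ?g] deg_p dg cA \<open>card A > 0\<close> by linarith
      hence "coeff (p * ?g) (card A - 1) = z None" using pair[of ?g] that dg k_pos by simp
      thus ?thesis using coeff_mult_le_degree[of p "k - 1" ?g "k - 1"] deg_p dg cA by simp
    qed
    have "y $ i = v i * proj_eval (k - 1) p (x i)" for i
    proof (cases "x i")
      case None
      hence "None \<in> range x" by (metis rangeI)
      thus ?thesis using inf None zx[of i] by (simp add: proj_eval_def)
    next
      case (Some a)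
      hence "a \<in> A" using fin_points by (metis rangeI)
      thus ?thesis using p(2) Some zx[of i] by (simp add: proj_eval_def)
    qed
    hence "y = (\<chi> i. v i * proj_eval (k - 1) p (x i))" by (simp add: vec_eq_iff)
    thus "y \<in> grs_code k x v" using deg_p by (auto simp: grs_code_def)
  qed
qed

end

text \<open>This reduces the theorem to finding points at which f' takes square values. These values
  are nonzero because the points are distinct, so their square roots can be inverted.\<close>

lemma mds_self_dual_code_of_points:
  fixes A :: "'a::field set"
  assumes "finite A" "even CARD('n::finite)"
    and "card A = CARD('n) \<or> card A + 1 = CARD('n) \<and> (\<exists>y::'a. y\<^sup>2 = - 1)"
    and sq: "\<And>a. a \<in> A \<Longrightarrow> \<exists>y. y\<^sup>2 = (\<Prod>b\<in>A - {a}. a - b)"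
  shows "\<exists>C :: ('a ^ 'n) set. linear_code C (CARD('n) div 2) \<and> mds C \<and> self_dual C"
proof -
  \<comment> \<open>\<open>S\<close> is the set of projective points, with infinity adjoined exactly
    when \<open>A\<close> is one point short of the length.\<close>
  obtain S where S: "card S = CARD('n)" "finite S" "\<And>a. Some a \<in> S \<longleftrightarrow> a \<in> A"
    "None \<in> S \<Longrightarrow> \<exists>y::'a. y\<^sup>2 = - 1"
  proof -
    consider "card A = CARD('n)" | "card A + 1 = CARD('n)" "\<exists>y::'a. y\<^sup>2 = - 1"
      using assms(3) by blast
    thus ?thesis
    proof cases
      case 1
      thus ?thesis using assms(1) by (intro that[of "Some ` A"]) (auto simp: card_image)
    next
      case 2
      thus ?thesis using assms(1) by (intro that[of "insert None (Some ` A)"]) (auto simp: card_image)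
    qed
  qed
  obtain x :: "'n \<Rightarrow> 'a option" where x: "bij_betw x UNIV S"
    using S(1,2) finite_same_card_bij[of "UNIV :: 'n set" S] by auto
  hence inj: "inj x" and range: "range x = S" by (auto simp: bij_betw_def)
  have "\<exists>y. y \<noteq> 0 \<and> y\<^sup>2 = (case x i of None \<Rightarrow> - 1 | Some a \<Rightarrow> 1 / (\<Prod>b\<in>A - {a}. a - b))" for i
  proof (cases "x i")
    case None
    hence "None \<in> S" using range by (metis rangeI)
    then obtain y :: 'a where y: "y\<^sup>2 = - 1" using S(4) by blast
    hence "y \<noteq> 0" by (auto simp: power2_eq_square)
    thus ?thesis using y None by (intro exI[of _ y]) simp
  next
    case (Some a)
    hence "a \<in> A" using range S(3) by (metis rangeI)
    then obtain y where y: "y\<^sup>2 = (\<Prod>b\<in>A - {a}. a - b)" using sq by blast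
    have "(\<Prod>b\<in>A - {a}. a - b) \<noteq> 0" using assms(1) by (simp add: prod_zero_iff)
    hence "y \<noteq> 0" using y by auto
    thus ?thesis using y Some by (intro exI[of _ "1 / y"]) (simp add: power_divide)
  qed
  then obtain v where "\<forall>i. v i \<noteq> 0 \<and>
      (v i)\<^sup>2 = (case x i of None \<Rightarrow> - 1 | Some a \<Rightarrow> 1 / (\<Prod>b\<in>A - {a}. a - b))"
    using choice[of "\<lambda>i y. y \<noteq> 0 \<and>
      y\<^sup>2 = (case x i of None \<Rightarrow> - 1 | Some a \<Rightarrow> 1 / (\<Prod>b\<in>A - {a}. a - b))"] by blast
  hence v: "\<And>i. v i \<noteq> 0"
    "\<And>i. (v i)\<^sup>2 = (case x i of None \<Rightarrow> - 1 | Some a \<Rightarrow> 1 / (\<Prod>b\<in>A - {a}. a - b))"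
    by simp_all
  obtain k where k: "CARD('n) = 2 * k" using assms(2) by blast
  have k_pos: "k > 0" using k by (metis mult_0_right neq0_conv zero_less_card_finite)
  have k_le: "k \<le> CARD('n)" using k by simp
  have "self_dual (grs_code k x v)"
    using inj assms(1) S(3) range v k k_pos
    by (intro self_dual_grs[where A = A]) auto
  thus ?thesis
    using linear_code_grs[where x = x and v = v, OF inj v(1) k_pos k_le]
      mds_grs[where x = x and v = v, OF inj v(1) k_pos k_le] k
    by (intro exI[of _ "grs_code k x v"]) simp
qed

section \<open>Points in cosets of the roots of unity\<close>

theorem theorem3:
  fixes q r m s t n :: nat
  assumes "CARD('a::{field,finite}) = q"
    and "CARD('n::finite) = n"
    and "q = r^2" and "odd r" and "primepow r"
    and "m > 0" and "s > 0"
    and "m dvd q - 1" and "even s" and "s dvd m" and "s dvd r + 1"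
    and "1 \<le> t" and "t \<le> s * (r - 1) div gcd (s * (r - 1)) m"
  shows "(n = t * m \<and> even ((q - 1) div m) \<and> even ((r + 1) div s) \<longrightarrow>
            (\<exists>C :: ('a ^ 'n) set. linear_code C (n div 2) \<and> mds C \<and> self_dual C))
       \<and> (n = t * m + 2 \<longrightarrow>
            (\<exists>C :: ('a ^ 'n) set. linear_code C (n div 2) \<and> mds C \<and> self_dual C))"
proof -
  have card_a: "CARD('a) = r\<^sup>2" using assms by simp
  note square = frobenius_fixed_is_square[OF card_a \<open>odd r\<close> \<open>primepow r\<close>]
    and diff = frobenius_fixed_diff[OF card_a \<open>odd r\<close> \<open>primepow r\<close>]
    and of_nat = frobenius_fixed_of_nat[OF card_a \<open>odd r\<close> \<open>primepow r\<close>]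
    and prod = frobenius_fixed_prod[OF card_a \<open>odd r\<close> \<open>primepow r\<close>]
  obtain \<theta> :: 'a where \<theta>: "\<theta> \<noteq> 0" "\<And>i. \<theta> ^ i = 1 \<longleftrightarrow> CARD('a) - 1 dvd i"
    by (rule finite_field_generator[where 'a = 'a]) (rule that)
  define e d where "e = (r + 1) div s" and "d = (q - 1) div m"
  have e: "r + 1 = e * s" and d: "q - 1 = d * m" using assms by (auto simp: e_def d_def)
  have r1: "r > 1" using \<open>primepow r\<close> primepow_gt_Suc_0 by simp
  have q1: "q - 1 = e * s * (r - 1)"
    using r1 unfolding e[symmetric] assms(3) by (simp add: power2_eq_square algebra_simps)
  have q_pos: "q - 1 > 0" using one_less_power[OF r1, of 2] assms(3) by simp
  have pos: "e > 0" using e by (cases e) auto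
  have pow_eq: "q - 1 dvd j - i" if "\<theta> ^ i = \<theta> ^ j" "i \<le> j" for i j
  proof -
    have "\<theta> ^ i * \<theta> ^ (j - i) = \<theta> ^ (i + (j - i))" by (rule power_add[symmetric])
    hence "\<theta> ^ i * \<theta> ^ (j - i) = \<theta> ^ i * 1" using that by simp
    thus ?thesis using \<theta> assms(1) by simp
  qed
  have pow_inj: "i = j" if "\<theta> ^ (c * i) = \<theta> ^ (c * j)" "q - 1 = c * c'" "i < c'" "j < c'" for c c' i j
    using that
  proof (induction i j rule: linorder_wlog)
    case (le i j)
    hence "c * c' dvd c * (j - i)" using pow_eq[of "c * i" "c * j"] by (simp add: diff_mult_distrib2)
    moreover have "c > 0" using le(3) q_pos by (cases c) auto
    ultimately have "c' dvd j - i" by simp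
    thus ?case using le by (auto dest: dvd_imp_le)
  qed simp
  define g where "g k = \<theta> ^ (e * m * k)" for k
  define A where "A = (\<lambda>(k, j). \<theta> ^ (e * k + d * j)) ` ({..<t} \<times> {..<m})"
  \<comment> \<open>The element \<theta>^d has order \<open>m\<close>, so the m-th power depends on
    the coset index \<open>k\<close> alone.\<close>
  have pow_m: "(\<theta> ^ (e * k + d * j)) ^ m = g k" for k j
  proof -
    have "\<theta> ^ (d * m * j) = 1" using \<theta>(2)[of "d * m * j"] assms(1) d by simp
    moreover have "(\<theta> ^ (e * k + d * j)) ^ m = \<theta> ^ (e * m * k) * \<theta> ^ (d * m * j)"
      by (simp add: algebra_simps flip: power_mult power_add)
    ultimately show ?thesis by (simp add: g_def)
  qed
  \<comment> \<open>The bound on \<open>t\<close> is used here: cancelling \<open>e\<close> and the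
    gcd, equality of the two powers makes \<open>s * (r - 1) div c\<close> divide the difference of
    the indices, which is below \<open>t\<close>.\<close>
  have g_inj: "i = j" if "g i = g j" "i < t" "j < t" for i j
    using that
  proof (induction i j rule: linorder_wlog)
    case (le i j)
    define c where "c = gcd (s * (r - 1)) m"
    have c: "c > 0" using \<open>m > 0\<close> by (simp add: c_def)
    have "e * (s * (r - 1)) dvd e * (m * (j - i))"
      using pow_eq[of "e * m * i" "e * m * j"] le q1 by (simp add: g_def diff_mult_distrib2 mult.assoc)
    hence dvd: "s * (r - 1) dvd m * (j - i)" using pos by simp
    obtain u w where uw: "s * (r - 1) = c * u" "m = c * w" "coprime u w"
      by (metis c_def \<open>m > 0\<close> gcd_coprime_exists gcd_eq_0_iff mult.commute neq0_conv)
    hence "u dvd w * (j - i)" using dvd c by simp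
    hence "u dvd j - i" using uw(3) by (simp add: coprime_dvd_mult_right_iff)
    moreover have "t \<le> s * (r - 1) div c" unfolding c_def by (rule assms(13))
    hence "t \<le> u" using c by (simp add: uw(1) del: One_nat_def)
    ultimately show ?case using le by (auto dest: dvd_imp_le)
  qed auto
  \<comment> \<open>The m-th power recovers \<open>k\<close>; within a coset \<open>j\<close> is
    then determined by the order of \<theta>^d.\<close>
  have "inj_on (\<lambda>(k, j). \<theta> ^ (e * k + d * j)) ({..<t} \<times> {..<m})"
  proof (rule inj_onI, clarify)
    fix k j k' j'
    assume *: "k < t" "j < m" "k' < t" "j' < m" "\<theta> ^ (e * k + d * j) = \<theta> ^ (e * k' + d * j')"
    have "g k = g k'" using pow_m * by metis
    hence k: "k = k'" using g_inj * by blast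
    hence "\<theta> ^ (d * j) = \<theta> ^ (d * j')" using *(5) \<theta>(1) by (simp add: power_add)
    thus "k = k' \<and> j = j'" using k pow_inj[OF _ d] * by blast
  qed
  hence card_A: "card A = t * m" by (simp add: A_def card_image card_cartesian_product)
  have fin_A: "finite A" by simp
  have root: "\<exists>k<t. a ^ m = g k" if "a \<in> A" for a
    using that pow_m by (auto simp: A_def)
  note deriv = prod_diff_coset_union[OF \<open>m > 0\<close> fin_A card_A root]
  \<comment> \<open>Writing m = s w, the exponent of \<open>g k ^ (r - 1)\<close> becomes (q - 1) w
    k.\<close>
  have g_fixed: "g k ^ r = g k" for k
  proof -
    obtain w where w: "m = s * w" using \<open>s dvd m\<close> by blast
    have "e * m * k * (r - 1) = (q - 1) * (w * k)" unfolding q1 w by (simp add: ac_simps)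
    hence "q - 1 dvd e * m * k * (r - 1)" by (metis dvd_triv_left)
    hence "g k ^ (r - 1) = 1" using \<theta>(2) assms(1) by (simp add: g_def flip: power_mult)
    moreover have "g k ^ r = g k * g k ^ (r - 1)" using r1 by (simp flip: power_Suc)
    ultimately show ?thesis by simp
  qed
  have one: "(1::'a) ^ r = 1" "(0::'a) ^ r = 0" using r1 by auto
  have even_m: "even m" using assms by auto
  have prod_fixed: "(of_nat m * (\<Prod>l\<in>{..<t} - {k}. g k - g l)) ^ r =
      of_nat m * (\<Prod>l\<in>{..<t} - {k}. g k - g l)" for k
    unfolding power_mult_distrib of_nat
    by (subst prod) (auto intro!: diff g_fixed)
  show ?thesis
  proof (intro conjI impI; (elim conjE)?)
    assume n: "n = t * m" and ev: "even ((q - 1) div m)" "even ((r + 1) div s)"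
    have "\<exists>C :: ('a ^ 'n) set. linear_code C (CARD('n) div 2) \<and> mds C \<and> self_dual C"
    proof (rule mds_self_dual_code_of_points[OF fin_A])
      show "even CARD('n)" using n even_m assms(2) by simp
      show "card A = CARD('n) \<or> card A + 1 = CARD('n) \<and> (\<exists>y::'a. y\<^sup>2 = - 1)"
        using n card_A assms(2) by simp
      fix a assume a: "a \<in> A"
      then obtain k j where kj: "a = \<theta> ^ (e * k + d * j)" "k < t" by (auto simp: A_def)
      \<comment> \<open>Both parity hypotheses of (i) enter here and make every point a
        square.\<close>
      have "even (e * k + d * j)" using ev by (simp add: e_def d_def)
      then obtain i where "e * k + d * j = 2 * i" by blast
      hence i: "a = (\<theta> ^ i)\<^sup>2" using kj by (simp add: mult.commute flip: power_mult)
      obtain y where y: "y\<^sup>2 = of_nat m * (\<Prod>l\<in>{..<t} - {k}. g k - g l)"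
        using square[OF prod_fixed] by blast
      have "a ^ m = g k" using pow_m kj(1) by simp
      hence "(\<Prod>b\<in>A - {a}. a - b) = a ^ (m - 1) * y\<^sup>2"
        using deriv[OF _ a _ kj(2)] unfolding y by (simp only: ac_simps)
      also have "\<dots> = ((\<theta> ^ i) ^ (m - 1) * y)\<^sup>2"
        unfolding i by (simp add: power_mult_distrib ac_simps flip: power_mult)
      finally show "\<exists>y. y\<^sup>2 = (\<Prod>b\<in>A - {a}. a - b)" by metis
    qed
    thus "\<exists>C :: ('a ^ 'n) set. linear_code C (n div 2) \<and> mds C \<and> self_dual C"
      using assms(2) by simp
  next
    assume n: "n = t * m + 2"
    have "0 \<notin> A" using \<theta>(1) by (auto simp: A_def)
    have "\<exists>C :: ('a ^ 'n) set. linear_code C (CARD('n) div 2) \<and> mds C \<and> self_dual C"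
    proof (rule mds_self_dual_code_of_points[where A = "insert 0 A"])
      show "finite (insert 0 A)" by simp
      show "even CARD('n)" using n even_m assms(2) by simp
      \<comment> \<open>The points of \<open>A\<close> together with 0 and infinity number
        \<open>t * m + 2\<close>; infinity requires a square root of -1, which exists because -1
        lies in the subfield.\<close>
      have "\<exists>y::'a. y\<^sup>2 = 0 - 1"
        by (rule square[OF diff]) (use one in auto)
      thus "card (insert 0 A) = CARD('n) \<or> card (insert 0 A) + 1 = CARD('n) \<and> (\<exists>y::'a. y\<^sup>2 = - 1)"
        using n card_A assms(2) \<open>0 \<notin> A\<close> by simp
      fix a assume a: "a \<in> insert 0 A"
      show "\<exists>y. y\<^sup>2 = (\<Prod>b\<in>insert 0 A - {a}. a - b)"
      proof (cases "a = 0")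
        case True
        \<comment> \<open>At the new point 0 the derivative is f(0), a product of subfield
          elements.\<close>
        have "(\<Prod>b\<in>insert 0 A - {a}. a - b) = poly (\<Prod>b\<in>A. [:-b, 1:]) 0"
          using True \<open>0 \<notin> A\<close> by (simp add: poly_prod)
        also have "\<dots> = (\<Prod>k<t. 0 - g k)"
          using prod_linear_coset_union[OF \<open>m > 0\<close> fin_A card_A root] \<open>m > 0\<close>
          by (simp add: poly_prod poly_monom power_0_left)
        finally have eq: "(\<Prod>b\<in>insert 0 A - {a}. a - b) = (\<Prod>k<t. 0 - g k)" .
        show ?thesis unfolding eq
          by (intro square prod diff one g_fixed)
      next
        case False
        hence aA: "a \<in> A" using a by simp
        then obtain k where k: "a ^ m = g k" "k < t" using root by blast
        \<comment> \<open>The factor \<open>a - 0\<close> completes \<open>a ^ (m - 1)\<close> to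
          \<open>a ^ m = g k\<close>, so the whole product lies in the subfield.\<close>
        have "insert 0 A - {a} = insert 0 (A - {a})" using False by auto
        hence "(\<Prod>b\<in>insert 0 A - {a}. a - b) = a * (\<Prod>b\<in>A - {a}. a - b)"
          using \<open>0 \<notin> A\<close> by simp
        also have "\<dots> = (a * a ^ (m - 1)) * (of_nat m * (\<Prod>l\<in>{..<t} - {k}. g k - g l))"
          using deriv[OF _ aA k] by (simp add: ac_simps)
        also have "a * a ^ (m - 1) = g k" using \<open>m > 0\<close> k(1) by (simp flip: power_Suc)
        finally have eq: "(\<Prod>b\<in>insert 0 A - {a}. a - b) =
          g k * (of_nat m * (\<Prod>l\<in>{..<t} - {k}. g k - g l))" .
        show ?thesis unfolding eq
          by (rule square) (simp only: power_mult_distrib[of "g k"] g_fixed prod_fixed)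
      qed
    qed
    thus "\<exists>C :: ('a ^ 'n) set. linear_code C (n div 2) \<and> mds C \<and> self_dual C"
      using assms(2) by simp
  qed
qed

end
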